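(* Let $\Lambda_f$ be a uniformly random numerical semigroup with Frobenius number $f$, and $g(\Lambda_f)$ its genus. There are constants $\gamma_0$ and $\gamma_1$ such that, as $f \to \infty$, $\mathbb{E}[g(\Lambda_f)] - \frac{3f}{4}$ converges to $\gamma_0$ along even $f$ and to $\gamma_1$ along odd $f$.
   Context: A numerical semigroup is a subset $\Lambda \subseteq \mathbb{N}_0$ containing $0$, closed under addition, with finite complement. Its genus is $g(\Lambda) = \#(\mathbb{N}_0 \setminus \Lambda)$, its conductor is the least $c$ with $c + \mathbb{N}_0 \subseteq \Lambda$, and its Frobenius number is the conductor minus $1$. *)

theory Defs
  imports Complex_Main
begin

definition numerical_semigroup :: "nat set \<Rightarrow> bool" where
  "numerical_semigroup S \<longleftrightarrow> 0 \<in> S \<and> (\<forall>a\<in>S. \<forall>b\<in>S. a + b \<in> S) \<and> finite (UNIV - S)"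

definition genus :: "nat set \<Rightarrow> nat" where
  "genus S = card (UNIV - S)"

definition conductor :: "nat set \<Rightarrow> nat" where
  "conductor S = (LEAST c. \<forall>n\<ge>c. n \<in> S)"

definition frobenius :: "nat set \<Rightarrow> int" where
  "frobenius S = int (conductor S) - 1"

definition semigroups_frob :: "nat \<Rightarrow> nat set set" where
  "semigroups_frob f = {S. numerical_semigroup S \<and> frobenius S = int f}"

definition expected_genus :: "nat \<Rightarrow> real" where
  "expected_genus f = (\<Sum>S\<in>semigroups_frob f. real (genus S)) / real (card (semigroups_frob f))"

end

theory Submission
  imports Defs "HOL-Analysis.Analysis"
begin

text \<open>
  Write \<open>f = 2k + e\<close> with \<open>e \<in> {0, 1}\<close>, and sort the semigroups by their multiplicity (least positive
  element) \<open>m = k - j\<close>, keeping aside those without positive elements up to \<open>k\<close>.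

  For fixed \<open>j\<close> and large \<open>k\<close>, closure under addition only constrains the elements near
  \<open>f/2\<close> and those near \<open>f\<close>; everything in between is a free set. Hence the number of such semigroups
  and the sum of \<open>g - 3f/4\<close> over them are both exactly a constant times \<open>2^k\<close>.

  Uniformly in \<open>k\<close>, there are at most \<open>2 \<rho>^j 2^k\<close> of them for some \<open>\<rho> < 1\<close>. To see this, write
  \<open>f = q m + r\<close> and pair the residues \<open>i, i'\<close> modulo \<open>m\<close> with \<open>i + i' \<equiv> r\<close>. Since \<open>f\<close> is a gap,
  the Kunz coordinates of a pair take at most \<open>2^n\<close> values, where \<open>n \<in> {q, q + 1}\<close> is the number of
  pairs \<open>{x, f - x}\<close> in these classes; this would give the bound \<open>2^k\<close>. For \<open>n \<ge> 4\<close> there are in fact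
  at most \<open>(63/32)^n\<close> values. For \<open>n = 3\<close>, where the count is exactly \<open>8\<close>, a factor \<open>63/64\<close> is gained for
  each odd \<open>i\<close> in a suitable interval because the coordinates of \<open>i\<close> and \<open>2i\<close> cannot be \<open>1\<close> and \<open>3\<close>.

  Tannery's theorem then shows that the number of semigroups and the sum of \<open>g - 3f/4\<close>, both divided by
  \<open>2^k\<close>, converge, the former to a positive limit.
\<close>

section \<open>Semigroups of given Frobenius number without reference to the conductor\<close>

lemma mem_semigroups_frob_iff:
  "S \<in> semigroups_frob f \<longleftrightarrow>
     0 \<in> S \<and> (\<forall>a\<in>S. \<forall>b\<in>S. a + b \<in> S) \<and> f \<notin> S \<and> (\<forall>x>f. x \<in> S)"
  (is "?L \<longleftrightarrow> ?R")
proof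
  assume L: ?L
  then have ns: "numerical_semigroup S" and c: "conductor S = Suc f"
    by (auto simp: semigroups_frob_def frobenius_def)
  then obtain b where "\<forall>x\<in>UNIV - S. x \<le> b"
    using finite_nat_set_iff_bounded_le numerical_semigroup_def by auto
  then have "\<forall>n\<ge>Suc b. n \<in> S"
    by (metis DiffI UNIV_I not_less_eq_eq)
  then have ge: "\<forall>n\<ge>Suc f. n \<in> S"
    unfolding c[symmetric] conductor_def by (rule LeastI)
  have "f \<notin> S"
  proof
    assume "f \<in> S"
    with ge have "\<forall>n\<ge>f. n \<in> S" by (metis le_antisym not_less_eq_eq)
    then have "conductor S \<le> f" unfolding conductor_def by (rule Least_le)
    with c show False by simp
  qed
  with ge ns show ?R by (auto simp: numerical_semigroup_def)
next
  assume R: ?R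
  have "conductor S = Suc f"
    unfolding conductor_def
  proof (rule Least_equality)
    show "\<forall>n\<ge>Suc f. n \<in> S" using R by auto
    show "Suc f \<le> c" if "\<forall>n\<ge>c. n \<in> S" for c
      using that R by (metis not_less_eq_eq)
  qed
  moreover have "UNIV - S \<subseteq> {..f}"
    using R by (metis DiffD2 atMost_iff not_le subsetI)
  ultimately show ?L
    using R finite_subset by (auto simp: semigroups_frob_def numerical_semigroup_def frobenius_def)
qed

subsection \<open>Kunz coordinates\<close>

definition mult_class :: "nat \<Rightarrow> nat \<Rightarrow> nat set set" where
  "mult_class f m = {S \<in> semigroups_frob f. m \<in> S \<and> (\<forall>x. 0 < x \<and> x < m \<longrightarrow> x \<notin> S)}"

text \<open>The argument \<open>i\<close> may exceed \<open>m\<close>, so that \<open>i + i'\<close>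
  needs no reduction modulo \<open>m\<close>; the carry is dealt with by
  \<open>kunz_add_modulus\<close>.\<close>

definition kunz :: "nat set \<Rightarrow> nat \<Rightarrow> nat \<Rightarrow> nat" where
  "kunz S m i = (LEAST k. i + k * m \<in> S)"

lemma add_mem_semigroup:
  assumes "S \<in> semigroups_frob f" "a \<in> S" "b \<in> S"
  shows "a + b \<in> S"
  using assms by (auto simp: mem_semigroups_frob_iff)

lemma multiple_mem_semigroup:
  assumes "S \<in> semigroups_frob f" "m \<in> S"
  shows "k * m \<in> S"
  using assms by (induction k) (auto simp: mem_semigroups_frob_iff)

lemma kunz_le_iff:
  assumes S: "S \<in> semigroups_frob f" and m: "m \<in> S" "m > 0"
  shows "kunz S m i \<le> k \<longleftrightarrow> i + k * m \<in> S"
proof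
  \<comment> \<open>The witness \<open>Suc f\<close> shows that the LEAST in \<open>kunz\<close> is
    attained.\<close>
  have "i + Suc f * m > f" using m(2)
    by (metis One_nat_def Suc_leI Suc_le_lessD mult.right_neutral mult_le_mono2 trans_le_add2)
  then have "i + Suc f * m \<in> S" using S by (auto simp: mem_semigroups_frob_iff)
  then have *: "i + kunz S m i * m \<in> S" unfolding kunz_def by (rule LeastI)
  assume "kunz S m i \<le> k"
  then obtain d where "k = kunz S m i + d" using le_Suc_ex by blast
  then have "i + k * m = (i + kunz S m i * m) + d * m" by (simp add: algebra_simps)
  then show "i + k * m \<in> S"
    using add_mem_semigroup[OF S * multiple_mem_semigroup[OF S m(1)]] by (simp only:)
next
  assume "i + k * m \<in> S"
  then show "kunz S m i \<le> k" unfolding kunz_def by (rule Least_le)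
qed

lemma kunz_mem:
  assumes "S \<in> semigroups_frob f" "m \<in> S" "m > 0"
  shows "i + kunz S m i * m \<in> S"
  using kunz_le_iff[OF assms] by blast

lemma kunz_determines:
  assumes "S \<in> semigroups_frob f" "m \<in> S" "S' \<in> semigroups_frob f" "m \<in> S'" "m > 0"
    and eq: "\<And>i. i < m \<Longrightarrow> kunz S m i = kunz S' m i"
  shows "S = S'"
proof (rule set_eqI)
  fix x
  have "x \<in> S \<longleftrightarrow> kunz S m (x mod m) \<le> x div m"
    using kunz_le_iff[OF assms(1,2,5), of "x mod m" "x div m"] by simp
  also have "\<dots> \<longleftrightarrow> kunz S' m (x mod m) \<le> x div m" using eq assms(5) by simp
  also have "\<dots> \<longleftrightarrow> x \<in> S'"
    using kunz_le_iff[OF assms(3,4,5), of "x mod m" "x div m"] by simp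
  finally show "x \<in> S \<longleftrightarrow> x \<in> S'" .
qed

lemma kunz_subadditive:
  assumes "S \<in> semigroups_frob f" "m \<in> S" "m > 0"
  shows "kunz S m (i + i') \<le> kunz S m i + kunz S m i'"
proof -
  have "(i + kunz S m i * m) + (i' + kunz S m i' * m) \<in> S"
    using kunz_mem[OF assms] add_mem_semigroup[OF assms(1)] by blast
  then show ?thesis unfolding kunz_le_iff[OF assms] by (simp add: algebra_simps)
qed

lemma kunz_add_modulus:
  assumes "S \<in> semigroups_frob f" "m \<in> S" "m > 0"
  shows "kunz S m i \<le> Suc (kunz S m (i + m))"
  using kunz_mem[OF assms, of "i + m"] unfolding kunz_le_iff[OF assms] by (simp add: algebra_simps)

subsection \<open>Exponentially few semigroups of small multiplicity\<close>

text \<open>An element is encoded by its coordinates, and for each \<open>i\<close> in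
  \<open>G\<close> one joint value at \<open>i\<close> and \<open>g i\<close> never occurs. Merging
  these two coordinates into one factor with that value removed saves \<open>\<theta>\<close> once
  per element of \<open>G\<close>.\<close>

lemma card_le_prod_excluding:
  fixes c :: "'s \<Rightarrow> 'i \<Rightarrow> 'v" and w :: "'i \<Rightarrow> real"
  assumes fin: "finite I" and fD: "\<And>i. i \<in> I \<Longrightarrow> finite (D i)"
    and G: "G \<subseteq> I" "g ` G \<subseteq> I" "inj_on g G" "G \<inter> g ` G = {}"
    and inj: "inj_on (\<lambda>s. restrict (c s) I) \<S>"
    and mem: "\<And>s i. s \<in> \<S> \<Longrightarrow> i \<in> I \<Longrightarrow> c s i \<in> D i"
    and excl: "\<And>s i. s \<in> \<S> \<Longrightarrow> i \<in> G \<Longrightarrow> (c s i, c s (g i)) \<noteq> z i"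
    and z: "\<And>i. i \<in> G \<Longrightarrow> z i \<in> D i \<times> D (g i)"
    and w: "\<And>i. i \<in> I \<Longrightarrow> real (card (D i)) \<le> w i"
    and wG: "\<And>i. i \<in> G \<Longrightarrow> real (card (D i)) * real (card (D (g i))) - 1 \<le> \<theta> * (w i * w (g i))"
  shows "real (card \<S>) \<le> \<theta> ^ card G * (\<Prod>i\<in>I. w i)"
proof -
  define J where "J = I - g ` G"
  \<comment> \<open>Outside \<open>G\<close> the factor is a diagonal copy of \<open>D i\<close>, so
    that merged and single coordinates share a type.\<close>
  define T where "T i = (if i \<in> G then D i \<times> D (g i) - {z i} else (\<lambda>x. (x, x)) ` D i)" for i
  define \<phi> where "\<phi> s = (\<lambda>i\<in>J. (c s i, c s (if i \<in> G then g i else i)))" for s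
  have GJ: "G \<subseteq> J" using G by (auto simp: J_def)
  have finT: "finite (T i)" if "i \<in> J" for i
    using that fD G by (auto simp: T_def J_def)
  have injphi: "inj_on \<phi> \<S>"
  proof (rule inj_onI)
    fix s s' assume s: "s \<in> \<S>" "s' \<in> \<S>" and eq: "\<phi> s = \<phi> s'"
    have J: "c s i = c s' i \<and> c s (if i \<in> G then g i else i) = c s' (if i \<in> G then g i else i)"
      if "i \<in> J" for i
      using fun_cong[OF eq, of i] that by (simp add: \<phi>_def)
    have "c s i = c s' i" if "i \<in> I" for i
    proof (cases "i \<in> J")
      case False
      then obtain i' where "i' \<in> G" "i = g i'" using \<open>i \<in> I\<close> unfolding J_def by blast
      then show ?thesis using J[of i'] GJ by auto
    qed (use J in auto)
    then have "restrict (c s) I = restrict (c s') I" by auto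
    with inj s show "s = s'" by (auto dest: inj_onD)
  qed
  have img: "\<phi> ` \<S> \<subseteq> (\<Pi>\<^sub>E i\<in>J. T i)"
  proof (intro image_subsetI PiE_I)
    fix s i assume s: "s \<in> \<S>" and i: "i \<in> J"
    show "\<phi> s i \<in> T i"
      using mem[OF s] excl[OF s] G i by (auto simp: \<phi>_def T_def J_def)
  qed (auto simp: \<phi>_def)
  have "finite J" using fin by (simp add: J_def)
  have cT: "real (card (T i)) \<le> (if i \<in> G then \<theta> * (w i * w (g i)) else w i)" if "i \<in> J" for i
  proof (cases "i \<in> G")
    case True
    have "card (T i) = card (D i \<times> D (g i)) - 1"
      using z[OF True] True by (simp add: T_def)
    moreover have "card (D i \<times> D (g i)) \<ge> 1"
      using z[OF True] fD True G by (metis (no_types, lifting) One_nat_def Suc_leI card_gt_0_iff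
          empty_iff finite_SigmaI image_subset_iff subsetD)
    ultimately have "real (card (T i)) = real (card (D i)) * real (card (D (g i))) - 1"
      by (simp add: card_cartesian_product)
    then show ?thesis using wG[OF True] True by simp
  next
    case False
    then show ?thesis using w[of i] that by (simp add: T_def J_def card_image inj_on_def)
  qed
  have "card \<S> = card (\<phi> ` \<S>)" using injphi by (simp add: card_image)
  also have "\<dots> \<le> card (\<Pi>\<^sub>E i\<in>J. T i)"
    using img finT \<open>finite J\<close> by (intro card_mono finite_PiE) auto
  also have "\<dots> = (\<Prod>i\<in>J. card (T i))" using \<open>finite J\<close> by (simp add: card_PiE)
  finally have "real (card \<S>) \<le> (\<Prod>i\<in>J. real (card (T i)))"
    by (metis of_nat_le_iff of_nat_prod)
  also have "\<dots> \<le> (\<Prod>i\<in>J. if i \<in> G then \<theta> * (w i * w (g i)) else w i)"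
    using cT by (intro prod_mono) auto
  also have "\<dots> = (\<Prod>i\<in>G. \<theta> * (w i * w (g i))) * (\<Prod>i\<in>J - G. w i)"
    using prod.subset_diff[OF GJ \<open>finite J\<close>, of "\<lambda>i. if i \<in> G then \<theta> * (w i * w (g i)) else w i"]
    by (simp add: mult.commute)
  also have "(\<Prod>i\<in>G. \<theta> * (w i * w (g i))) = \<theta> ^ card G * ((\<Prod>i\<in>G. w i) * (\<Prod>i\<in>g ` G. w i))"
    using G(3) by (simp add: prod.distrib prod.reindex)
  also have "(\<Prod>i\<in>G. w i) * (\<Prod>i\<in>g ` G. w i) = (\<Prod>i\<in>G \<union> g ` G. w i)"
    using G fin by (subst prod.union_disjoint) (auto intro: finite_subset)
  also have "\<theta> ^ card G * (\<Prod>i\<in>G \<union> g ` G. w i) * (\<Prod>i\<in>J - G. w i) =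
             \<theta> ^ card G * ((\<Prod>i\<in>I - (G \<union> g ` G). w i) * (\<Prod>i\<in>G \<union> g ` G. w i))"
    by (simp add: J_def set_diff_eq Un_def conj_commute conj_left_commute mult_ac)
  also have "(\<Prod>i\<in>I - (G \<union> g ` G). w i) * (\<Prod>i\<in>G \<union> g ` G. w i) = (\<Prod>i\<in>I. w i)"
    using prod.subset_diff[of "G \<union> g ` G" I w] G fin by auto
  finally show ?thesis .
qed

text \<open>
  The possible Kunz coordinates at residues \<open>i, i'\<close> with \<open>i + i' = r\<close> (then \<open>n = q + 1\<close>) or
  \<open>i + i' = r + m\<close> (then \<open>n = q\<close>).
\<close>

definition pair_levels :: "nat \<Rightarrow> (nat \<times> nat) set" where
  "pair_levels n = {(u, v). 1 \<le> u \<and> u \<le> n \<and> 1 \<le> v \<and> v \<le> n \<and> n \<le> u + v}"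

section \<open>Counting the admissible pairs of Kunz coordinates\<close>

lemma finite_pair_levels: "finite (pair_levels n)"
  by (rule finite_subset[of _ "{..n} \<times> {..n}"]) (auto simp: pair_levels_def)

lemma card_pair_levels: "2 * card (pair_levels (Suc n)) = n\<^sup>2 + 5 * n + 2"
proof -
  have "pair_levels (Suc n) = Sigma {1..Suc n} (\<lambda>u. {max 1 (Suc n - u)..Suc n})"
    by (auto simp: pair_levels_def)
  then have "card (pair_levels (Suc n)) = (\<Sum>u=1..Suc n. Suc (Suc n) - max 1 (Suc n - u))"
    by simp
  \<comment> \<open>For \<open>u <= n\<close> there are \<open>u + 1\<close> choices of
    \<open>v\<close>; for \<open>u = n + 1\<close> the bound \<open>1 <= v\<close> takes over and
    leaves \<open>n + 1\<close>.\<close>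
  also have "\<dots> = (\<Sum>u=1..n. u + 1) + Suc n"
    by (simp add: sum.atLeast_Suc_atMost_Suc_shift) (intro sum.cong, auto)
  also have "2 * \<dots> = n\<^sup>2 + 5 * n + 2"
    by (induction n) (auto simp: power2_eq_square algebra_simps)
  finally show ?thesis .
qed

lemma card_pair_levels_3: "card (pair_levels 3) = 8"
  using card_pair_levels[of 2] by (simp add: eval_nat_numeral)

lemma card_pair_levels_4: "card (pair_levels 4) = 13"
  using card_pair_levels[of 3] by (simp add: eval_nat_numeral)

lemma card_pair_levels_step:
  assumes "n \<ge> 1"
  shows "card (pair_levels (Suc n)) = card (pair_levels n) + n + 2"
proof -
  obtain l where "n = Suc l" using assms by (cases n) auto
  then show ?thesis using card_pair_levels[of l] card_pair_levels[of n]
    by (simp add: power2_eq_square algebra_simps)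
qed

lemma card_pair_levels_ge:
  assumes "n \<ge> 4"
  shows "card (pair_levels n) \<ge> 2 * n + 5"
  using assms by (induction n rule: dec_induct) (auto simp: card_pair_levels_4 card_pair_levels_step)

text \<open>At \<open>n = 3\<close> this fails, since 8 exceeds (63/32)^3. From \<open>n = 4\<close>
  on, the increment \<open>n + 2\<close> is at most 31/32 of the current value, which is at least
  \<open>2 * n + 5\<close>.\<close>

lemma card_pair_levels_le:
  assumes "n \<ge> 4"
  shows "real (card (pair_levels n)) \<le> (63/32) ^ n"
  using assms
proof (induction n rule: dec_induct)
  case base
  then show ?case by (simp add: card_pair_levels_4 power4_eq_xxxx)
next
  case (step n)
  have "real (card (pair_levels n)) \<ge> 2 * real n + 5"
    using card_pair_levels_ge[OF step(1)] by linarith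
  then have "real (card (pair_levels (Suc n))) \<le> 63/32 * real (card (pair_levels n))"
    using step(1) by (simp add: card_pair_levels_step)
  also have "\<dots> \<le> 63/32 * (63/32) ^ n" using step by simp
  finally show ?case by simp
qed

lemma card_pair_levels_le_two_power:
  assumes "n \<ge> 2"
  shows "real (card (pair_levels n)) \<le> 2 ^ n"
proof -
  consider "n = 2" | "n = 3" | "n \<ge> 4" using assms by linarith
  then show ?thesis
  proof cases
    case 1
    then show ?thesis using card_pair_levels[of 1] by (simp add: eval_nat_numeral)
  next
    case 2
    then show ?thesis by (simp add: card_pair_levels_3)
  next
    case 3
    have "(63/32 :: real) ^ n \<le> 2 ^ n" by (intro power_mono) auto
    with card_pair_levels_le[OF 3] show ?thesis by linarith
  qed
qed

lemma kunz_mult_class_bounds: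
  assumes S: "S \<in> mult_class (q * m + r) m" and r: "0 < r" "r < m"
  shows "kunz S m r = Suc q"
    and "0 < i \<Longrightarrow> i < m \<Longrightarrow> 1 \<le> kunz S m i"
    and "i < r \<Longrightarrow> kunz S m i \<le> Suc q"
    and "r < i \<Longrightarrow> kunz S m i \<le> q"
    and "i + i' = r \<Longrightarrow> Suc q \<le> kunz S m i + kunz S m i'"
    and "i + i' = r + m \<Longrightarrow> q \<le> kunz S m i + kunz S m i'"
proof -
  have S': "S \<in> semigroups_frob (q * m + r)" and m: "m \<in> S" "m > 0"
    and small: "\<And>x. 0 < x \<Longrightarrow> x < m \<Longrightarrow> x \<notin> S"
    using S r by (auto simp: mult_class_def)
  note iff = kunz_le_iff[OF S' m]
  have big: "x \<in> S" if "x > q * m + r" for x using S' that by (auto simp: mem_semigroups_frob_iff)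
  have "q * m + r \<notin> S" using S' by (auto simp: mem_semigroups_frob_iff)
  \<comment> \<open>The Frobenius number is a gap at level \<open>q\<close> of the class of
    \<open>r\<close>, and the next level already exceeds it. The lower bounds on sums then follow by
    subadditivity, with one level lost to the carry when \<open>i + i' = r + m\<close>.\<close>
  then have "\<not> kunz S m r \<le> q" by (simp add: iff add.commute)
  moreover have "kunz S m r \<le> Suc q" unfolding iff using m by (intro big) simp
  ultimately show *: "kunz S m r = Suc q" by simp
  show "1 \<le> kunz S m i" if "0 < i" "i < m"
    using iff[of i 0] small[OF that] by simp
  show "kunz S m i \<le> Suc q" if "i < r"
    unfolding iff using r by (intro big) simp
  show "kunz S m i \<le> q" if "r < i"
    unfolding iff using that by (intro big) simp
  show "Suc q \<le> kunz S m i + kunz S m i'" if "i + i' = r"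
    using kunz_subadditive[OF S' m, of i i'] * that by simp
  show "q \<le> kunz S m i + kunz S m i'" if "i + i' = r + m"
    using kunz_subadditive[OF S' m, of i i'] kunz_add_modulus[OF S' m, of r] * that by simp
qed

text \<open>\<open>I\<close> holds one representative of each pair of residues with sum
  \<open>r\<close> or \<open>r + m\<close>; the residues 0 and \<open>r\<close> have forced
  coordinates. The weight \<open>w\<close> is left open because different ranges of \<open>q\<close>
  call for different bounds on the number of values of a pair.\<close>

lemma card_mult_class_le:
  fixes q m r :: nat and w :: "nat \<Rightarrow> real"
  defines "I \<equiv> {1..r div 2} \<union> {Suc r..r + (m - r) div 2}"
  defines "n \<equiv> (\<lambda>i. if i < r then Suc q else q)"
  assumes r: "0 < r" "r < m"
    and G: "G \<subseteq> I" "\<And>i. i \<in> G \<Longrightarrow> odd i \<and> 2 * i \<in> I \<and> n i = 3 \<and> n (2 * i) = 3"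
    and w: "\<And>l. l = q \<or> l = Suc q \<Longrightarrow> real (card (pair_levels l)) \<le> w l"
    and w3: "G \<noteq> {} \<Longrightarrow> w 3 = 8"
  shows "real (card (mult_class (q * m + r) m)) \<le>
           (63/64) ^ card G * (w (Suc q) ^ (r div 2) * w q ^ ((m - r) div 2))"
proof -
  define \<sigma> where "\<sigma> i = (if i < r then r - i else r + m - i)" for i
  define c where "c S i = (kunz S m i, kunz S m (\<sigma> i))" for S i
  have I: "0 < i \<and> i < m \<and> i \<noteq> r" if "i \<in> I" for i
    using that r by (auto simp: I_def)
  have inj: "inj_on (\<lambda>S. restrict (c S) I) (mult_class (q * m + r) m)"
  proof (rule inj_onI)
    fix S S' assume S: "S \<in> mult_class (q * m + r) m" and S': "S' \<in> mult_class (q * m + r) m"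
      and eq: "restrict (c S) I = restrict (c S') I"
    have I_eq: "kunz S m i = kunz S' m i \<and> kunz S m (\<sigma> i) = kunz S' m (\<sigma> i)" if "i \<in> I" for i
      using fun_cong[OF eq, of i] that by (simp add: c_def)
    have "kunz S m i = kunz S' m i" if "i < m" for i
    proof -
      \<comment> \<open>The residue or its partner lies in the lower half of its block, hence in
        \<open>I\<close>. A residue that is its own partner belongs to \<open>I\<close> as
        well.\<close>
      have lower: "i = 0 \<or> i \<in> I \<or> \<sigma> i \<in> I \<and> \<sigma> (\<sigma> i) = i" if "i < r"
        using that by (cases "2 * i \<le> r") (auto simp: I_def \<sigma>_def)
      have upper: "i \<in> I \<or> \<sigma> i \<in> I \<and> \<sigma> (\<sigma> i) = i" if "r < i"
        using that \<open>i < m\<close> r by (cases "2 * i \<le> r + m") (auto simp: I_def \<sigma>_def)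
      consider "i = 0" | "i = r" | "i \<in> I" | "\<sigma> i \<in> I \<and> \<sigma> (\<sigma> i) = i"
        using lower upper by (metis linorder_neqE_nat)
      then show ?thesis
      proof cases
        case 1
        then show ?thesis using S S' by (simp add: kunz_def mult_class_def mem_semigroups_frob_iff)
      next
        case 2
        then show ?thesis using kunz_mult_class_bounds(1)[OF _ r] S S' by simp
      qed (use I_eq[of i] I_eq[of "\<sigma> i"] in auto)
    qed
    then show "S = S'"
      using S S' r kunz_determines[of S "q * m + r" m S'] by (auto simp: mult_class_def)
  qed
  have mem: "c S i \<in> pair_levels (n i)" if S: "S \<in> mult_class (q * m + r) m" and i: "i \<in> I" for S i
    using kunz_mult_class_bounds(2-4)[OF S r, of i] kunz_mult_class_bounds(2-4)[OF S r, of "\<sigma> i"]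
      kunz_mult_class_bounds(5-6)[OF S r, of i "\<sigma> i"] I[OF i] r
    by (auto simp: c_def pair_levels_def n_def \<sigma>_def split: if_splits)
  \<comment> \<open>A coordinate 1 at \<open>i\<close> forces a coordinate at most 2 at
    \<open>2 * i\<close>. One of the 8 * 8 joint values is thus lost, which gives 63/64.\<close>
  have excl: "(c S i, c S (2 * i)) \<noteq> ((1, 2), (3, 3))"
    if S: "S \<in> mult_class (q * m + r) m" for S i
    using kunz_subadditive[of S "q * m + r" m i i] S r
    by (auto simp: c_def mult_class_def mult_2)
  have "real (card (mult_class (q * m + r) m)) \<le> (63/64) ^ card G * (\<Prod>i\<in>I. w (n i))"
  proof (rule card_le_prod_excluding[where D = "\<lambda>i. pair_levels (n i)" and g = "(*) 2"
        and z = "\<lambda>_. ((1, 2), (3, 3))" and c = c])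
    show "finite I" by (simp add: I_def)
    \<comment> \<open>Taking only odd indices keeps the merged pairs \<open>i\<close>,
      \<open>2 * i\<close> disjoint from one another.\<close>
    have "2 * i \<notin> G" for i using G(2)[of "2 * i"] by auto
    then show "G \<inter> (*) 2 ` G = {}" by auto
    show "inj_on ((*) 2) G" by (simp add: inj_on_def)
    show "((1, 2), (3, 3)) \<in> pair_levels (n i) \<times> pair_levels (n (2 * i))" if "i \<in> G" for i
      using G(2)[OF that] by (simp add: pair_levels_def)
    show "real (card (pair_levels (n i))) \<le> w (n i)" if "i \<in> I" for i
      using w by (simp add: n_def)
    show "real (card (pair_levels (n i))) * real (card (pair_levels (n (2 * i)))) - 1
            \<le> 63 / 64 * (w (n i) * w (n (2 * i)))" if "i \<in> G" for i
    proof -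
      have "w 3 = 8" using that w3 by auto
      then show ?thesis using G(2)[OF that] by (simp add: card_pair_levels_3)
    qed
  qed (use G inj mem excl finite_pair_levels in auto)
  also have "(\<Prod>i\<in>I. w (n i)) = (\<Prod>i\<in>{1..r div 2}. w (n i)) * (\<Prod>i\<in>{Suc r..r + (m - r) div 2}. w (n i))"
    unfolding I_def by (rule prod.union_disjoint) auto
  also have "(\<Prod>i\<in>{1..r div 2}. w (n i)) = (\<Prod>i\<in>{1..r div 2}. w (Suc q))"
    using r by (intro prod.cong) (auto simp: n_def)
  also have "(\<Prod>i\<in>{Suc r..r + (m - r) div 2}. w (n i)) = (\<Prod>i\<in>{Suc r..r + (m - r) div 2}. w q)"
    by (intro prod.cong) (auto simp: n_def)
  finally show ?thesis by simp
qed

lemma mult_class_dvd_empty: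
  assumes "m dvd f"
  shows "mult_class f m = {}"
proof -
  obtain k where k: "f = k * m" using assms by (metis dvdE mult.commute)
  have False if S: "S \<in> mult_class f m" for S
  proof -
    have "f \<in> S" using S multiple_mem_semigroup[of S f m k] by (simp add: mult_class_def k)
    then show False using S by (simp add: mult_class_def mem_semigroups_frob_iff)
  qed
  then show ?thesis by blast
qed

text \<open>The number \<open>p\<close> of factors 63/64 gained must be linear in the distance of
  \<open>m\<close> from \<open>f div 2\<close>. Which pairs of residues yield the gain depends on
  \<open>q = f div m\<close> and, for \<open>q = 3\<close>, on the size of \<open>r\<close>.\<close>

lemma card_mult_class_geometric:
  fixes m f :: nat
  assumes m: "0 < m" "2 * m \<le> f"
  shows "\<exists>p. real (card (mult_class f m)) \<le> 2 ^ (f div 2) * (63/64) ^ p \<and> f div 2 - m \<le> 16 * p + 16"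
proof (cases "m dvd f")
  case True
  then show ?thesis by (intro exI[of _ "f"]) (simp add: mult_class_dvd_empty)
next
  case False
  define q r where "q = f div m" and "r = f mod m"
  have f: "f = q * m + r" by (simp add: q_def r_def)
  have r: "0 < r" "r < m" using False m by (auto simp: r_def mod_greater_zero_iff_not_dvd)
  have q2: "q \<ge> 2" using m by (simp add: q_def less_eq_div_iff_mult_less_eq)
  \<comment> \<open>Without any gain the bound \<open>2 ^ n\<close> per pair of residues already
    multiplies up to at most \<open>2 ^ (f div 2)\<close>.\<close>
  have expo: "Suc q * (r div 2) + q * ((m - r) div 2) \<le> f div 2"
  proof -
    have "2 * (Suc q * (r div 2) + q * ((m - r) div 2)) =
        Suc q * (2 * (r div 2)) + q * (2 * ((m - r) div 2))" by (simp add: algebra_simps)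
    also have "\<dots> \<le> Suc q * r + q * (m - r)" by (intro add_mono mult_le_mono) auto
    also have "\<dots> = f" using r by (simp add: f algebra_simps diff_mult_distrib2)
    finally show ?thesis by (simp add: less_eq_div_iff_mult_less_eq mult.commute)
  qed
  have prod_le: "(b ^ Suc q) ^ (r div 2) * (b ^ q) ^ ((m - r) div 2) \<le> b ^ (f div 2)"
    if "b \<ge> 1" for b :: real
    using power_increasing[OF expo that] by (simp only: power_add power_mult)
  have two: "real (card (pair_levels l)) \<le> 2 ^ l" if "l = q \<or> l = Suc q" for l
    using that q2 by (intro card_pair_levels_le_two_power) auto
  have gain: "real (card (mult_class f m)) \<le> 2 ^ (f div 2) * (63/64) ^ card G"
    if "G \<subseteq> {1..r div 2} \<union> {Suc r..r + (m - r) div 2}"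
      and "\<And>i. i \<in> G \<Longrightarrow> odd i \<and> 2 * i \<in> {1..r div 2} \<union> {Suc r..r + (m - r) div 2} \<and>
        (if i < r then Suc q else q) = 3 \<and> (if 2 * i < r then Suc q else q) = 3" for G
  proof -
    have "real (card (mult_class f m)) \<le>
       (63/64) ^ card G * ((2 ^ Suc q) ^ (r div 2) * (2 ^ q) ^ ((m - r) div 2))"
      unfolding f using that by (intro card_mult_class_le r two) auto
    also have "\<dots> \<le> (63/64) ^ card G * 2 ^ (f div 2)"
      using prod_le[of 2] by (intro mult_left_mono) auto
    finally show ?thesis by (simp add: mult.commute)
  qed
  consider "q = 2" | "q = 3" "6 * r < m" | "q = 3" "6 * r \<ge> m" | "q \<ge> 4" using q2 by linarith
  then show ?thesis
  proof cases
    case 1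
    \<comment> \<open>The pairs below \<open>r\<close> have \<open>n = 3\<close>. Odd
      \<open>i\<close> with \<open>4 * i <= r\<close> keep \<open>2 * i\<close> among their
      representatives, and \<open>f div 2 - m\<close> is only \<open>r div 2\<close>.\<close>
    let ?G = "(\<lambda>t. 2 * t + 1) ` {..<(r + 4) div 8}"
    have "card ?G = (r + 4) div 8" by (subst card_image) (auto simp: inj_on_def)
    moreover have "real (card (mult_class f m)) \<le> 2 ^ (f div 2) * (63/64) ^ card ?G"
    proof (rule gain)
      have G: "2 * (2 * i) \<le> r \<and> 0 < i \<and> odd i" if "i \<in> ?G" for i
      proof -
        from that obtain t where t: "i = 2 * t + 1" "t < (r + 4) div 8" by auto
        then have "8 * t + 4 \<le> r" by linarith
        with t show ?thesis by simp
      qed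
      show "?G \<subseteq> {1..r div 2} \<union> {Suc r..r + (m - r) div 2}"
      proof
        fix i assume "i \<in> ?G"
        from G[OF this] have "1 \<le> i" "i \<le> r div 2" by linarith+
        then show "i \<in> {1..r div 2} \<union> {Suc r..r + (m - r) div 2}" by simp
      qed
      fix i assume "i \<in> ?G"
      from G[OF this] have "1 \<le> 2 * i" "2 * i \<le> r div 2" "i < r" "2 * i < r" "odd i" by linarith+
      then show "odd i \<and> 2 * i \<in> {1..r div 2} \<union> {Suc r..r + (m - r) div 2} \<and>
        (if i < r then Suc q else q) = 3 \<and> (if 2 * i < r then Suc q else q) = 3"
        using 1 by simp
    qed
    moreover have "f div 2 - m \<le> 16 * ((r + 4) div 8) + 16" using f unfolding 1 by linarith
    ultimately show ?thesis by metis
  next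
    case 2
    \<comment> \<open>Now the pairs above \<open>r\<close> have \<open>n = 3\<close>: the odd
      \<open>i > r\<close> with \<open>4 * i <= r + m\<close> are taken.\<close>
    let ?G = "(\<lambda>t. 2 * t + 1) ` {(r + 1) div 2..<(r + m + 4) div 8}"
    have "card ?G = (r + m + 4) div 8 - (r + 1) div 2" by (subst card_image) (auto simp: inj_on_def)
    moreover have "real (card (mult_class f m)) \<le> 2 ^ (f div 2) * (63/64) ^ card ?G"
    proof (rule gain)
      have G: "2 * (2 * i) \<le> r + m \<and> r < i \<and> odd i" if "i \<in> ?G" for i
      proof -
        from that obtain t where t: "i = 2 * t + 1" "t < (r + m + 4) div 8" "(r + 1) div 2 \<le> t" by auto
        then have "8 * t + 4 \<le> r + m" "r < 2 * t + 1" by linarith+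
        with t show ?thesis by simp
      qed
      show "?G \<subseteq> {1..r div 2} \<union> {Suc r..r + (m - r) div 2}"
      proof
        fix i assume "i \<in> ?G"
        from G[OF this] r have "Suc r \<le> i" "i \<le> r + (m - r) div 2" by linarith+
        then show "i \<in> {1..r div 2} \<union> {Suc r..r + (m - r) div 2}" by simp
      qed
      fix i assume "i \<in> ?G"
      from G[OF this] r have "Suc r \<le> 2 * i" "2 * i \<le> r + (m - r) div 2" "r < i" "odd i" by linarith+
      then show "odd i \<and> 2 * i \<in> {1..r div 2} \<union> {Suc r..r + (m - r) div 2} \<and>
        (if i < r then Suc q else q) = 3 \<and> (if 2 * i < r then Suc q else q) = 3"
        using 2 by simp
    qed
    \<comment> \<open>As \<open>6 * r < m\<close>, up to rounding \<open>G\<close> has (m - 3r)/8 >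
      m/16 elements, while f/2 - m = (m + r)/2 < 7m/12.\<close>
    moreover have "f div 2 - m \<le> 16 * ((r + m + 4) div 8 - (r + 1) div 2) + 16"
      using f 2(2) r unfolding 2(1) by linarith
    ultimately show ?thesis by metis
  next
    case 3
    \<comment> \<open>The pairs below \<open>r\<close> have \<open>n = 4\<close>, hence 13 values
      instead of 16. With \<open>6 * r >= m\<close> there are enough of them for \<open>G\<close> to
      be empty.\<close>
    have "real (card (mult_class f m)) \<le>
       (13/16 * 2 ^ Suc q) ^ (r div 2) * (2 ^ q) ^ ((m - r) div 2)"
    proof -
      have "real (card (pair_levels l)) \<le> (if l = 4 then 13 else 8)" if "l = q \<or> l = Suc q" for l
        using that 3(1) card_pair_levels_3 card_pair_levels_4 by auto
      from card_mult_class_le[OF r, of "{}" q "\<lambda>l. if l = 4 then 13 else 8", OF _ _ this] show ?thesis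
        unfolding f by (simp add: 3(1))
    qed
    also have "\<dots> = (13/16) ^ (r div 2) * ((2 ^ Suc q) ^ (r div 2) * (2 ^ q) ^ ((m - r) div 2))"
      by (simp only: power_mult_distrib mult.assoc)
    also have "\<dots> \<le> (63/64) ^ (r div 2) * 2 ^ (f div 2)"
      using prod_le[of 2] by (intro mult_mono power_mono) auto
    finally have "real (card (mult_class f m)) \<le> 2 ^ (f div 2) * (63/64) ^ (r div 2)"
      by (simp add: mult.commute)
    moreover have "f div 2 - m \<le> 16 * (r div 2) + 16" using f 3(2) unfolding 3(1) by linarith
    ultimately show ?thesis by blast
  next
    case 4
    have "real (card (mult_class f m)) \<le>
       (63/64) ^ card ({} :: nat set) * (((63/32) ^ Suc q) ^ (r div 2) * ((63/32) ^ q) ^ ((m - r) div 2))"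
      unfolding f using 4 by (intro card_mult_class_le r card_pair_levels_le) auto
    also have "\<dots> \<le> (63/32) ^ (f div 2)" using prod_le[of "63/32"] by simp
    also have "\<dots> = 2 ^ (f div 2) * (63/64) ^ (f div 2)"
      by (simp add: power_mult_distrib[symmetric])
    finally show ?thesis by (intro exI[of _ "f div 2"]) auto
  qed
qed

lemma mult_class_geometric_decay:
  obtains \<rho> :: real where "0 < \<rho>" "\<rho> < 1"
    "\<And>m f. 0 < m \<Longrightarrow> 2 * m \<le> f \<Longrightarrow>
       real (card (mult_class f m)) \<le> 2 * 2 ^ (f div 2) * \<rho> ^ (f div 2 - m)"
proof
  \<comment> \<open>The 16th root turns \<open>16 * p\<close> into \<open>p\<close> factors 63/64;
    the additive 16 costs one more such factor, absorbed by the leading 2.\<close>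
  define \<rho> :: real where "\<rho> = root 16 (63/64)"
  show \<rho>: "0 < \<rho>" "\<rho> < 1" by (simp_all add: \<rho>_def)
  have \<rho>16: "\<rho> ^ 16 = 63/64" unfolding \<rho>_def by (rule real_root_pow_pos2) auto
  fix m f :: nat assume "0 < m" "2 * m \<le> f"
  from card_mult_class_geometric[OF this] obtain p where
    p: "real (card (mult_class f m)) \<le> 2 ^ (f div 2) * (63/64) ^ p" "f div 2 - m \<le> 16 * p + 16"
    by blast
  have "(63/64) * (63/64 :: real) ^ p = \<rho> ^ (16 * p + 16)"
    by (simp add: power_add power_mult \<rho>16)
  also have "\<dots> \<le> \<rho> ^ (f div 2 - m)" using p(2) \<rho> by (intro power_decreasing) auto
  finally have "(63/64 :: real) ^ p \<le> 2 * \<rho> ^ (f div 2 - m)" 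
    using zero_le_power[of "\<rho>" "f div 2 - m"] \<rho>(1) by linarith
  then have "2 ^ (f div 2) * (63/64) ^ p \<le> 2 ^ (f div 2) * (2 * \<rho> ^ (f div 2 - m))"
    by (intro mult_left_mono) auto
  also have "\<dots> = 2 * 2 ^ (f div 2) * \<rho> ^ (f div 2 - m)" by simp
  finally show "real (card (mult_class f m)) \<le> 2 * 2 ^ (f div 2) * \<rho> ^ (f div 2 - m)"
    using p(1) by linarith
qed

subsection \<open>Semigroups of multiplicity close to half the Frobenius number\<close>

lemma complement_semigroup_subset:
  assumes "S \<in> semigroups_frob f"
  shows "UNIV - S \<subseteq> {1..f}"
proof
  fix x assume "x \<in> UNIV - S"
  then have "x \<noteq> 0" "\<not> f < x" using assms by (metis DiffD2 mem_semigroups_frob_iff)+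
  then show "x \<in> {1..f}" by simp
qed

lemma finite_semigroups_frob: "finite (semigroups_frob f)"
proof (rule finite_subset)
  show "semigroups_frob f \<subseteq> uminus ` Pow {1..f}"
  proof
    fix S assume "S \<in> semigroups_frob f"
    then have "UNIV - S \<in> Pow {1..f}" using complement_semigroup_subset by blast
    moreover have "S = - (UNIV - S)" by auto
    ultimately show "S \<in> uminus ` Pow {1..f}" by (rule rev_image_eqI)
  qed
qed simp

lemma genus_le_frobenius:
  assumes "S \<in> semigroups_frob f"
  shows "genus S \<le> f"
  using card_mono[OF _ complement_semigroup_subset[OF assms]] by (simp add: genus_def)

lemma genus_eq:
  assumes "S \<in> semigroups_frob f"
  shows "genus S = f - card (S \<inter> {1..f})"
proof -
  have "UNIV - S = {1..f} - S \<inter> {1..f}" using complement_semigroup_subset[OF assms] by auto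
  then show ?thesis by (simp add: genus_def card_Diff_subset)
qed

text \<open>
  For \<open>d < m\<close>, a semigroup of multiplicity \<open>m\<close> and Frobenius number \<open>2m + d\<close> is described by the set
  \<open>P\<close> of offsets of its elements in \<open>[m, m + d]\<close>, the set \<open>Q\<close> of offsets in \<open>[2m, 2m + d)\<close>, and an
  arbitrary set \<open>Z\<close> of elements in between. Since \<open>d \<notin> Q\<close>, the condition below also says that the
  Frobenius number is not a sum of two elements.
\<close>

definition windows :: "nat \<Rightarrow> (nat set \<times> nat set) set" where
  "windows d = {(P, Q). P \<subseteq> {..d} \<and> 0 \<in> P \<and> Q \<subseteq> {..<d} \<and>
     (\<forall>p\<in>P. \<forall>p'\<in>P. p + p' \<le> d \<longrightarrow> p + p' \<in> Q)}"

definition assemble :: "nat \<Rightarrow> nat \<Rightarrow> (nat set \<times> nat set) \<times> nat set \<Rightarrow> nat set" where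
  "assemble m d = (\<lambda>((P, Q), Z). {0} \<union> (+) m ` P \<union> Z \<union> (+) (2 * m) ` Q \<union> {2 * m + d<..})"

lemma assemble_mem:
  assumes "d < m" "(P, Q) \<in> windows d" "Z \<subseteq> {m + d<..<2 * m}"
  shows "assemble m d ((P, Q), Z) \<in> mult_class (2 * m + d) m"
proof -
  let ?S = "assemble m d ((P, Q), Z)"
  have P: "P \<subseteq> {..d}" "0 \<in> P" and Q: "Q \<subseteq> {..<d}"
    and PQ: "\<And>p p'. p \<in> P \<Longrightarrow> p' \<in> P \<Longrightarrow> p + p' \<le> d \<Longrightarrow> p + p' \<in> Q"
    using assms(2) by (auto simp: windows_def)
  have S: "?S = {0} \<union> (+) m ` P \<union> Z \<union> (+) (2 * m) ` Q \<union> {2 * m + d<..}"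
    by (simp add: assemble_def)
  have ge: "x = 0 \<or> m \<le> x" if "x \<in> ?S" for x
    using that assms by (auto simp: S)
  have low: "\<exists>p\<in>P. x = m + p" if "x \<in> ?S" "x \<noteq> 0" "x \<le> m + d" for x
    using that assms P by (auto simp: S)
  have "a + b \<in> ?S" if a: "a \<in> ?S" and b: "b \<in> ?S" for a b
  proof (cases "a = 0 \<or> b = 0 \<or> a + b > 2 * m + d")
    case True
    then show ?thesis using a b by (auto simp: S)
  next
    \<comment> \<open>Both summands are at least \<open>m\<close> and their sum is at most
      \<open>2 * m + d\<close>, so both lie in the first window.\<close>
    case False
    then obtain p p' where p: "p \<in> P" "a = m + p" "p' \<in> P" "b = m + p'"
      using ge[OF a] ge[OF b] low[OF a] low[OF b] by force
    then have "p + p' \<in> Q" using False by (intro PQ) auto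
    moreover have "a + b = 2 * m + (p + p')" using p by simp
    ultimately show ?thesis unfolding S by blast
  qed
  moreover have "2 * m + d \<notin> ?S" using assms P Q by (auto simp: S)
  moreover have "m \<in> ?S" using P by (force simp: S)
  moreover have "\<forall>x. 0 < x \<and> x < m \<longrightarrow> x \<notin> ?S" using ge by force
  ultimately show ?thesis
    by (auto simp: mult_class_def mem_semigroups_frob_iff S)
qed

text \<open>The inverse reads off the two windows and the part between them; \<open>d < m\<close>
  keeps these ranges disjoint.\<close>

lemma bij_betw_assemble:
  assumes "d < m"
  shows "bij_betw (assemble m d) (windows d \<times> Pow {m + d<..<2 * m}) (mult_class (2 * m + d) m)"
proof (rule bij_betw_byWitness)
  let ?c = "\<lambda>S. (({p. p \<le> d \<and> m + p \<in> S}, {q. q < d \<and> 2 * m + q \<in> S}), S \<inter> {m + d<..<2 * m})"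
  show "\<forall>x\<in>windows d \<times> Pow {m + d<..<2 * m}. ?c (assemble m d x) = x"
  proof
    fix x assume x: "x \<in> windows d \<times> Pow {m + d<..<2 * m}"
    obtain P Q Z where x_eq: "x = ((P, Q), Z)" by (metis surj_pair)
    with x have PQ: "(P, Q) \<in> windows d" and Z: "Z \<subseteq> {m + d<..<2 * m}" by auto
    have P: "p \<le> d" if "p \<in> P" for p using PQ that by (auto simp: windows_def)
    have Q: "q < d" if "q \<in> Q" for q using PQ that by (auto simp: windows_def)
    have Z': "m + d < z" "z < 2 * m" if "z \<in> Z" for z using Z that by auto
    have "m + p \<in> assemble m d ((P, Q), Z) \<longleftrightarrow> p \<in> P" if "p \<le> d" for p
      using that assms Z'(1)[of "m + p"] by (auto simp: assemble_def)
    moreover have "2 * m + q \<in> assemble m d ((P, Q), Z) \<longleftrightarrow> q \<in> Q" if "q < d" for q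
    proof -
      have "2 * m + q \<noteq> m + p" if "p \<in> P" for p using P[OF that] assms by simp
      then show ?thesis
        using that assms Z'(2)[of "2 * m + q"] by (auto simp: assemble_def)
    qed
    moreover have "z \<in> assemble m d ((P, Q), Z) \<longleftrightarrow> z \<in> Z" if "m + d < z" "z < 2 * m" for z
    proof -
      have "z \<noteq> m + p" if "p \<in> P" for p using P[OF that] \<open>m + d < z\<close> by simp
      then show ?thesis using that by (auto simp: assemble_def)
    qed
    ultimately show "?c (assemble m d x) = x"
      unfolding x_eq using P Q Z' by auto
  qed
  show "\<forall>S\<in>mult_class (2 * m + d) m. assemble m d (?c S) = S"
  proof
    fix S assume S: "S \<in> mult_class (2 * m + d) m"
    then have *: "0 \<in> S" "2 * m + d \<notin> S" "\<And>x. 2 * m + d < x \<Longrightarrow> x \<in> S"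
      "\<And>x. 0 < x \<Longrightarrow> x < m \<Longrightarrow> x \<notin> S"
      by (auto simp: mult_class_def mem_semigroups_frob_iff)
    have shift: "(+) a ` {p. R p \<and> a + p \<in> S} = S \<inter> {x. a \<le> x \<and> R (x - a)}" for a R
      by (auto intro!: image_eqI[of _ "(+) a" "_ - a"])
    have nz: "m \<le> x \<and> x \<noteq> 2 * m + d" if "x \<in> S" "x \<noteq> 0" for x
      using *(2) *(4)[of x] that by (metis neq0_conv not_le)
    show "assemble m d (?c S) = S"
    proof (rule set_eqI)
      fix x
      show "x \<in> assemble m d (?c S) \<longleftrightarrow> x \<in> S"
        using *(1) *(3)[of x] nz[of x] assms by (cases "x = 0") (auto simp: assemble_def shift)
    qed
  qed
  show "assemble m d ` (windows d \<times> Pow {m + d<..<2 * m}) \<subseteq> mult_class (2 * m + d) m"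
    using assemble_mem[OF assms] by auto
  show "?c ` mult_class (2 * m + d) m \<subseteq> windows d \<times> Pow {m + d<..<2 * m}"
  proof (rule image_subsetI)
    fix S assume "S \<in> mult_class (2 * m + d) m"
    then have S: "S \<in> semigroups_frob (2 * m + d)" and m: "m \<in> S" by (auto simp: mult_class_def)
    \<comment> \<open>Equality \<open>p + p' = d\<close> would put the Frobenius number into
      \<open>S\<close>.\<close>
    have "p + p' < d \<and> 2 * m + (p + p') \<in> S" if "p + p' \<le> d" "m + p \<in> S" "m + p' \<in> S" for p p'
    proof -
      have "2 * m + (p + p') \<in> S"
        using add_mem_semigroup[OF S that(2,3)] by (simp add: mult_2 add_ac)
      moreover have "2 * m + d \<notin> S" using S by (simp add: mem_semigroups_frob_iff)
      ultimately show ?thesis using that(1) by (metis le_neq_implies_less)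
    qed
    then show "?c S \<in> windows d \<times> Pow {m + d<..<2 * m}"
      using m by (auto simp: windows_def)
  qed
qed

lemma genus_assemble:
  assumes "d < m" "(P, Q) \<in> windows d" "Z \<subseteq> {m + d<..<2 * m}"
  shows "real (genus (assemble m d ((P, Q), Z))) =
           real (2 * m + d) - real (card P) - real (card Q) - real (card Z)"
proof -
  let ?S = "assemble m d ((P, Q), Z)"
  have P: "P \<subseteq> {..d}" and Q: "Q \<subseteq> {..<d}"
    using assms(2) by (auto simp: windows_def)
  have fin: "finite P" "finite Q" "finite Z"
    using P Q assms(3) by (auto intro: finite_subset)
  have S: "?S \<in> semigroups_frob (2 * m + d)"
    using assemble_mem[OF assms] by (simp add: mult_class_def)
  have "?S \<inter> {1..2 * m + d} = (+) m ` P \<union> (Z \<union> (+) (2 * m) ` Q)"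
    using P Q assms by (auto simp: assemble_def)
  also have "card \<dots> = card P + (card Z + card Q)"
  proof -
    have low: "x \<le> m + d" if "x \<in> (+) m ` P" for x using that P by auto
    have mid: "m + d < x \<and> x < 2 * m" if "x \<in> Z" for x using that assms(3) by auto
    have high: "2 * m \<le> x" if "x \<in> (+) (2 * m) ` Q" for x using that by auto
    have "x \<notin> Z \<union> (+) (2 * m) ` Q" if "x \<in> (+) m ` P" for x
      using low[OF that] mid[of x] high[of x] assms(1) by fastforce
    then have "(+) m ` P \<inter> (Z \<union> (+) (2 * m) ` Q) = {}" by blast
    moreover have "Z \<inter> (+) (2 * m) ` Q = {}" using mid high by fastforce
    ultimately show ?thesis using fin by (simp add: card_Un_disjoint card_image)
  qed
  finally have "card (?S \<inter> {1..2 * m + d}) = card P + (card Z + card Q)" .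
  moreover have "card (?S \<inter> {1..2 * m + d}) \<le> 2 * m + d"
    using card_mono[of "{1..2 * m + d}" "?S \<inter> {1..2 * m + d}"] by simp
  ultimately show ?thesis using genus_eq[OF S] by linarith
qed

section \<open>Total deviation of the genus from 3f/4 within a class\<close>

lemma sum_card_Pow:
  assumes "finite A"
  shows "(\<Sum>Z\<in>Pow A. real (card Z)) = real (card A) / 2 * 2 ^ card A"
proof -
  \<comment> \<open>Complementation in \<open>A\<close> shows that the average size is half of
    \<open>card A\<close>.\<close>
  have "(\<Sum>Z\<in>Pow A. real (card Z)) = (\<Sum>Z\<in>Pow A. real (card (A - Z)))"
    by (rule sum.reindex_bij_witness[of _ "\<lambda>Z. A - Z" "\<lambda>Z. A - Z"])
      (auto simp: double_diff)
  also have "\<dots> = (\<Sum>Z\<in>Pow A. real (card A) - real (card Z))"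
    using assms by (intro sum.cong refl) (auto simp: card_Diff_subset finite_subset card_mono)
  finally show ?thesis using assms by (simp add: sum_subtractf card_Pow mult.commute)
qed

lemma sum_Pow_diff_card:
  fixes a :: real
  assumes "finite A"
  shows "(\<Sum>Z\<in>Pow A. a - real (card Z)) = (a - real (card A) / 2) * 2 ^ card A"
  using assms by (simp add: sum_subtractf sum_card_Pow card_Pow algebra_simps)

definition excess :: "nat \<Rightarrow> nat set \<Rightarrow> real" where
  "excess f S = real (genus S) - 3 * real f / 4"

lemma abs_excess_le:
  assumes "S \<in> semigroups_frob f"
  shows "\<bar>excess f S\<bar> \<le> real f"
  using genus_le_frobenius[OF assms] by (simp add: excess_def abs_le_iff)

lemma card_mult_class_large:
  assumes "d < m"
  shows "card (mult_class (2 * m + d) m) = card (windows d) * 2 ^ (m - d - 1)"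
proof -
  have "card {m + d<..<2 * m} = m - d - 1" by simp
  then show ?thesis
    using bij_betw_same_card[OF bij_betw_assemble[OF assms]]
    by (simp add: card_cartesian_product card_Pow)
qed

text \<open>Averaging over the free set replaces \<open>card Z\<close> by (m - d - 1)/2. Then (2m +
  d)/4 - (m - d - 1)/2 = (3d + 2)/4 is free of \<open>m\<close>: this is why 3f/4 is the right
  centring.\<close>

lemma sum_excess_mult_class_large:
  assumes "d < m"
  shows "(\<Sum>S\<in>mult_class (2 * m + d) m. excess (2 * m + d) S) =
    (\<Sum>(P, Q)\<in>windows d. (3 * real d + 2) / 4 - real (card P) - real (card Q)) * 2 ^ (m - d - 1)"
proof -
  let ?A = "{m + d<..<2 * m}"
  have A: "finite ?A" "card ?A = m - d - 1" using assms by auto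
  have "(\<Sum>S\<in>mult_class (2 * m + d) m. excess (2 * m + d) S) =
        (\<Sum>x\<in>windows d \<times> Pow ?A. excess (2 * m + d) (assemble m d x))"
    by (rule sum.reindex_bij_betw[OF bij_betw_assemble[OF assms], symmetric])
  also have "\<dots> = (\<Sum>W\<in>windows d. \<Sum>Z\<in>Pow ?A. excess (2 * m + d) (assemble m d (W, Z)))"
    by (simp add: sum.cartesian_product)
  also have "\<dots> = (\<Sum>(P, Q)\<in>windows d.
      ((3 * real d + 2) / 4 - real (card P) - real (card Q)) * 2 ^ (m - d - 1))"
  proof (rule sum.cong[OF refl], clarify)
    fix P Q assume PQ: "(P, Q) \<in> windows d"
    have "(\<Sum>Z\<in>Pow ?A. excess (2 * m + d) (assemble m d ((P, Q), Z))) =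
       (\<Sum>Z\<in>Pow ?A. (real (2 * m + d) / 4 - real (card P) - real (card Q)) - real (card Z))"
      using genus_assemble[OF assms PQ]
      by (intro sum.cong) (auto simp: excess_def add_divide_distrib)
    also have "\<dots> = (real (2 * m + d) / 4 - real (card P) - real (card Q) - real (card ?A) / 2)
        * 2 ^ card ?A"
      using A(1) by (rule sum_Pow_diff_card)
    also have "\<dots> = ((3 * real d + 2) / 4 - real (card P) - real (card Q)) * 2 ^ (m - d - 1)"
      using assms by (simp add: A(2) field_simps)
    finally show "(\<Sum>Z\<in>Pow ?A. excess (2 * m + d) (assemble m d ((P, Q), Z))) = \<dots>" .
  qed
  finally show ?thesis by (simp add: sum_distrib_right case_prod_unfold)
qed

section \<open>Semigroups whose positive elements all exceed k\<close>

definition top_class :: "nat \<Rightarrow> nat \<Rightarrow> nat set set" where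
  "top_class f k = {S \<in> semigroups_frob f. \<forall>x. 0 < x \<and> x \<le> k \<longrightarrow> x \<notin> S}"

text \<open>Two positive elements sum to at least \<open>2 * k + 2 > f\<close>, so closure imposes
  no condition between \<open>k\<close> and \<open>f\<close>.\<close>

lemma bij_betw_top_class:
  assumes "k < f" "f < 2 * k + 2"
  shows "bij_betw (\<lambda>Z. {0} \<union> Z \<union> {f<..}) (Pow {k<..<f}) (top_class f k)"
proof (rule bij_betw_byWitness[where f' = "\<lambda>S. S \<inter> {k<..<f}"])
  show "\<forall>Z\<in>Pow {k<..<f}. ({0} \<union> Z \<union> {f<..}) \<inter> {k<..<f} = Z" by auto
  show "\<forall>S\<in>top_class f k. {0} \<union> S \<inter> {k<..<f} \<union> {f<..} = S"
  proof
    fix S assume "S \<in> top_class f k"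
    then have *: "0 \<in> S" "f \<notin> S" "\<And>x. f < x \<Longrightarrow> x \<in> S" "\<And>x. 0 < x \<Longrightarrow> x \<le> k \<Longrightarrow> x \<notin> S"
      by (auto simp: top_class_def mem_semigroups_frob_iff)
    have "x = 0 \<or> k < x \<and> x < f \<or> f < x" if "x \<in> S" for x
      using *(2) *(4)[of x] that by (metis linorder_neqE_nat not_gr_zero not_less)
    note split = this
    show "{0} \<union> S \<inter> {k<..<f} \<union> {f<..} = S"
    proof (rule set_eqI)
      fix x
      show "x \<in> {0} \<union> S \<inter> {k<..<f} \<union> {f<..} \<longleftrightarrow> x \<in> S"
        using *(1) *(3)[of x] split[of x] by auto
    qed
  qed
  show "(\<lambda>Z. {0} \<union> Z \<union> {f<..}) ` Pow {k<..<f} \<subseteq> top_class f k"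
  proof clarify
    fix Z assume Z: "Z \<subseteq> {k<..<f}"
    then have Zk: "x > k \<and> x < f" if "x \<in> Z" for x using that by auto
    have "a + b > f" if "a \<in> Z \<union> {f<..}" "b \<in> Z \<union> {f<..}" for a b
      using that assms(2) Zk[of a] Zk[of b] by auto
    then have "\<forall>a\<in>{0} \<union> Z \<union> {f<..}. \<forall>b\<in>{0} \<union> Z \<union> {f<..}. a + b \<in> {0} \<union> Z \<union> {f<..}"
      by fastforce
    moreover have "f \<notin> {0} \<union> Z \<union> {f<..}" using assms(1) Zk[of f] by auto
    moreover have "x \<notin> {0} \<union> Z \<union> {f<..}" if "0 < x" "x \<le> k" for x
      using assms that Zk[of x] by auto
    ultimately show "{0} \<union> Z \<union> {f<..} \<in> top_class f k"
      by (simp add: top_class_def mem_semigroups_frob_iff)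
  qed
qed auto

lemma card_top_class:
  assumes "k < f" "f < 2 * k + 2"
  shows "card (top_class f k) = 2 ^ (f - k - 1)"
  using bij_betw_same_card[OF bij_betw_top_class[OF assms]] assms by (simp add: card_Pow)

lemma sum_excess_top_class:
  assumes "k < f" "f < 2 * k + 2"
  shows "(\<Sum>S\<in>top_class f k. excess f S) = (real (2 * k + 2) - real f) / 4 * 2 ^ (f - k - 1)"
proof -
  let ?A = "{k<..<f}"
  have A: "finite ?A" "card ?A = f - k - 1" using assms by auto
  have "(\<Sum>S\<in>top_class f k. excess f S) = (\<Sum>Z\<in>Pow ?A. excess f ({0} \<union> Z \<union> {f<..}))"
    by (rule sum.reindex_bij_betw[OF bij_betw_top_class[OF assms], symmetric])
  also have "\<dots> = (\<Sum>Z\<in>Pow ?A. real f / 4 - real (card Z))"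
  proof (rule sum.cong[OF refl])
    fix Z assume Z: "Z \<in> Pow ?A"
    then have "{0} \<union> Z \<union> {f<..} \<in> semigroups_frob f"
      using bij_betwE[OF bij_betw_top_class[OF assms]] by (auto simp: top_class_def)
    from genus_eq[OF this] have "genus ({0} \<union> Z \<union> {f<..}) = f - card (({0} \<union> Z \<union> {f<..}) \<inter> {1..f})" .
    also have "({0} \<union> Z \<union> {f<..}) \<inter> {1..f} = Z" using Z by auto
    finally have "genus ({0} \<union> Z \<union> {f<..}) = f - card Z" .
    moreover have "card Z \<le> f" using card_mono[OF A(1), of Z] Z A(2) by simp
    ultimately show "excess f ({0} \<union> Z \<union> {f<..}) = real f / 4 - real (card Z)"
      by (simp add: excess_def)
  qed
  also have "\<dots> = (real f / 4 - real (card ?A) / 2) * 2 ^ card ?A"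
    using A(1) by (rule sum_Pow_diff_card)
  also have "\<dots> = (real (2 * k + 2) - real f) / 4 * 2 ^ (f - k - 1)"
    using assms by (simp add: A(2) field_simps)
  finally show ?thesis .
qed

lemma sum_semigroups_frob_split:
  fixes h :: "nat set \<Rightarrow> real"
  shows "(\<Sum>S\<in>semigroups_frob f. h S) =
     (\<Sum>S\<in>top_class f k. h S) + (\<Sum>m\<in>{1..k}. \<Sum>S\<in>mult_class f m. h S)"
proof -
  have fin: "finite (top_class f k)" "finite (mult_class f m)" for m
    using finite_semigroups_frob by (auto simp: top_class_def mult_class_def)
  have "S \<in> top_class f k \<union> (\<Union>m\<in>{1..k}. mult_class f m)" if S: "S \<in> semigroups_frob f" for S
  proof (cases "\<exists>x. 0 < x \<and> x \<le> k \<and> x \<in> S")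
    case True
    define m where "m = (LEAST x. 0 < x \<and> x \<in> S)"
    have ex: "\<exists>x. 0 < x \<and> x \<in> S" using True by blast
    have m: "0 < m \<and> m \<in> S" unfolding m_def by (rule LeastI_ex[OF ex])
    moreover have "m \<le> k" using True Least_le[of "\<lambda>x. 0 < x \<and> x \<in> S"] unfolding m_def
      by (metis le_trans)
    moreover have "x \<notin> S" if "0 < x" "x < m" for x
      using not_less_Least[of x "\<lambda>x. 0 < x \<and> x \<in> S"] that unfolding m_def by blast
    ultimately have "S \<in> mult_class f m" "m \<in> {1..k}" using S by (auto simp: mult_class_def)
    then show ?thesis by blast
  qed (use S in \<open>auto simp: top_class_def\<close>)
  then have "semigroups_frob f = top_class f k \<union> (\<Union>m\<in>{1..k}. mult_class f m)"
    by (auto simp: top_class_def mult_class_def)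
  also have "sum h \<dots> = (\<Sum>S\<in>top_class f k. h S) + (\<Sum>S\<in>(\<Union>m\<in>{1..k}. mult_class f m). h S)"
    using fin by (intro sum.union_disjoint) (auto simp: top_class_def mult_class_def)
  also have "(\<Sum>S\<in>(\<Union>m\<in>{1..k}. mult_class f m). h S) = (\<Sum>m\<in>{1..k}. \<Sum>S\<in>mult_class f m. h S)"
  proof (rule sum.UNION_disjoint)
    show "\<forall>m\<in>{1..k}. \<forall>m'\<in>{1..k}. m \<noteq> m' \<longrightarrow> mult_class f m \<inter> mult_class f m' = {}"
      by (auto simp: mult_class_def Suc_le_eq) (metis linorder_neqE_nat)
  qed (use fin in auto)
  finally show ?thesis .
qed

subsection \<open>Convergence\<close>

text \<open>Applied with weight 1 to count the semigroups and with weight \<open>excess\<close>; the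
  bound \<open>real f + 1\<close> covers both.\<close>

lemma normalized_sum_convergent:
  fixes wt :: "nat \<Rightarrow> nat set \<Rightarrow> real"
  assumes e: "e \<le> 1"
    and bound: "\<And>f S. S \<in> semigroups_frob f \<Longrightarrow> \<bar>wt f S\<bar> \<le> real f + 1"
    and large: "\<And>m d. d < m \<Longrightarrow>
      (\<Sum>S\<in>mult_class (2 * m + d) m. wt (2 * m + d) S) = c d * 2 ^ (m - d - 1)"
    and top: "\<And>k. 1 \<le> k \<Longrightarrow> (\<Sum>S\<in>top_class (2 * k + e) k. wt (2 * k + e) S) = t * 2 ^ k"
  shows "convergent (\<lambda>k. (\<Sum>S\<in>semigroups_frob (2 * k + e). wt (2 * k + e) S) / 2 ^ k)"
proof -
  obtain \<rho> :: real where \<rho>: "0 < \<rho>" "\<rho> < 1" and decay: "\<And>m f. 0 < m \<Longrightarrow> 2 * m \<le> f \<Longrightarrow>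
       real (card (mult_class f m)) \<le> 2 * 2 ^ (f div 2) * \<rho> ^ (f div 2 - m)"
    using mult_class_geometric_decay by blast
  define g where "g k m = (\<Sum>S\<in>mult_class (2 * k + e) m. wt (2 * k + e) S)" for k m
  \<comment> \<open>Contribution of multiplicity \<open>k - j\<close>, set to zero for
    \<open>j >= k\<close> so that the finite sum over multiplicities becomes a series in
    \<open>j\<close>.\<close>
  define a where "a j k = (if j < k then g k (k - j) / 2 ^ k else 0)" for j k
  define b where "b j = c (2 * j + e) / 2 ^ (3 * j + e + 1)" for j
  define M where "M j = 12 * (real (Suc j) * \<rho> ^ j)" for j
  \<comment> \<open>With \<open>m = k - j\<close> and \<open>d = 2 * j + e\<close>, the condition
    \<open>d < m\<close> reads \<open>3 * j + e < k\<close>. The exponent \<open>m - d - 1\<close>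
    is then \<open>k - (3 * j + e + 1)\<close>, so dividing by \<open>2 ^ k\<close> removes
    \<open>k\<close>.\<close>
  have stable: "a j k = b j" if "3 * j + e < k" for j k
  proof -
    define l where "l = k - (3 * j + e + 1)"
    have k: "k = l + (3 * j + e + 1)" using that by (simp add: l_def)
    have "g k (k - j) = (\<Sum>S\<in>mult_class (2 * (k - j) + (2 * j + e)) (k - j).
        wt (2 * (k - j) + (2 * j + e)) S)"
    proof -
      have "2 * (k - j) + (2 * j + e) = 2 * k + e" using that by simp
      then show ?thesis by (simp only: g_def)
    qed
    also have "\<dots> = c (2 * j + e) * 2 ^ (k - j - (2 * j + e) - 1)"
      using that by (intro large) simp
    also have "k - j - (2 * j + e) - 1 = l" by (simp add: k)
    finally have "g k (k - j) / 2 ^ k = c (2 * j + e) * 2 ^ l / (2 ^ l * 2 ^ (3 * j + e + 1))"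
      by (simp only: k power_add)
    then show ?thesis using that by (simp add: a_def b_def)
  qed
  \<comment> \<open>In this range \<open>f\<close> is bounded linearly in \<open>j\<close>, so the
    weight costs only a factor \<open>6 * j + 6\<close> against the geometric decay.\<close>
  have small: "\<bar>a j k\<bar> \<le> M j" if "k \<le> 3 * j + e + 1" for j k
  proof (cases "j < k")
    case True
    let ?f = "2 * k + e"
    have "\<bar>g k (k - j)\<bar> \<le> (\<Sum>S\<in>mult_class ?f (k - j). \<bar>wt ?f S\<bar>)"
      unfolding g_def by (rule sum_abs)
    also have "\<dots> \<le> (\<Sum>S\<in>mult_class ?f (k - j). real ?f + 1)"
      by (intro sum_mono bound) (auto simp: mult_class_def)
    also have "\<dots> = (real ?f + 1) * real (card (mult_class ?f (k - j)))" by simp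
    also have "\<dots> \<le> (6 * real j + 6) * (2 * 2 ^ k * \<rho> ^ j)"
    proof (rule mult_mono)
      have "?f + 1 \<le> 6 * j + 6" using that e by linarith
      then show "real ?f + 1 \<le> 6 * real j + 6" by linarith
      show "real (card (mult_class ?f (k - j))) \<le> 2 * 2 ^ k * \<rho> ^ j"
        using decay[of "k - j" ?f] True e by simp
    qed auto
    also have "\<dots> = M j * 2 ^ k" by (simp add: M_def algebra_simps)
    finally show ?thesis using True by (simp add: a_def field_simps)
  next
    case False
    then show ?thesis using \<rho> by (simp add: a_def M_def)
  qed
  have M_bound: "\<bar>a j k\<bar> \<le> M j" for j k
  proof (cases "3 * j + e < k")
    case True
    \<comment> \<open>At \<open>k = 3 * j + e + 1\<close> both \<open>stable\<close> and
      \<open>small\<close> apply, so the bound carries over to all larger \<open>k\<close>, where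
      the weight bound alone would grow with \<open>k\<close>.\<close>
    then have "a j k = a j (3 * j + e + 1)" by (simp add: stable)
    then show ?thesis using small by simp
  qed (use small in simp)
  have "summable M"
    unfolding M_def using geometric_deriv_sums[of \<rho>] \<rho>
    by (intro summable_mult sums_summable) auto
  moreover have "((\<lambda>k. a j k) \<longlongrightarrow> b j) sequentially" for j
    using stable by (intro tendsto_eventually eventually_sequentiallyI[of "3 * j + e + 1"]) auto
  ultimately have lim: "(\<lambda>k. \<Sum>j. a j k) \<longlonglongrightarrow> suminf b"
    using tannerys_theorem[of a b sequentially M] M_bound by (simp add: case_prod_unfold)
  have "t + (\<Sum>j. a j k) = (\<Sum>S\<in>semigroups_frob (2 * k + e). wt (2 * k + e) S) / 2 ^ k"
    if "1 \<le> k" for k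
  proof -
    have "(\<Sum>m\<in>{1..k}. g k m) = (\<Sum>j<k. g k (k - j))"
      by (rule sum.reindex_bij_witness[of _ "\<lambda>j. k - j" "\<lambda>m. k - m"]) auto
    moreover have "(\<Sum>j. a j k) = (\<Sum>j<k. g k (k - j)) / 2 ^ k"
      by (subst suminf_finite[of "{..<k}"]) (auto simp: a_def sum_divide_distrib)
    ultimately show ?thesis
      unfolding sum_semigroups_frob_split[of _ "2 * k + e" k] using top[OF that]
      by (simp add: g_def add_divide_distrib)
  qed
  then have "\<forall>\<^sub>F k in sequentially. t + (\<Sum>j. a j k) =
      (\<Sum>S\<in>semigroups_frob (2 * k + e). wt (2 * k + e) S) / 2 ^ k"
    by (auto intro: eventually_sequentiallyI)
  with tendsto_add[OF tendsto_const lim, of t] show ?thesis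
    unfolding convergent_def by (blast intro: Lim_transform_eventually)
qed

section \<open>Limits of the normalized count, of the total deviation and of their quotient\<close>

lemma card_semigroups_frob_convergent:
  assumes "e \<le> 1"
  obtains L where "L > 0" "(\<lambda>k. real (card (semigroups_frob (2 * k + e))) / 2 ^ k) \<longlonglongrightarrow> L"
proof -
  have top: "real (card (top_class (2 * k + e) k)) = 2 ^ e / 2 * 2 ^ k" if "1 \<le> k" for k
  proof -
    have "card (top_class (2 * k + e) k) = 2 ^ (k + e - 1)"
      using that assms by (subst card_top_class) auto
    then show ?thesis using that by (cases k) (auto simp: power_add)
  qed
  have "convergent (\<lambda>k. (\<Sum>S\<in>semigroups_frob (2 * k + e). 1) / 2 ^ k :: real)"
    by (rule normalized_sum_convergent[OF assms, where c = "\<lambda>d. real (card (windows d))"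
          and t = "2 ^ e / 2"])
      (use top card_mult_class_large in auto)
  then obtain L where L: "(\<lambda>k. real (card (semigroups_frob (2 * k + e))) / 2 ^ k) \<longlonglongrightarrow> L"
    by (auto simp: convergent_def)
  \<comment> \<open>The top class alone supplies a fixed positive share of \<open>2 ^ k\<close>,
    which keeps the limit away from zero.\<close>
  have lower: "2 ^ e / 2 \<le> real (card (semigroups_frob (2 * k + e))) / 2 ^ k" if "1 \<le> k" for k
  proof -
    have "card (top_class (2 * k + e) k) \<le> card (semigroups_frob (2 * k + e))"
      by (intro card_mono finite_semigroups_frob) (auto simp: top_class_def)
    then show ?thesis using top[OF that] by (simp add: field_simps)
  qed
  have "2 ^ e / 2 \<le> L"
    by (rule LIMSEQ_le_const[OF L]) (intro exI[of _ 1] allI impI lower)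
  moreover have "(0 :: real) < 2 ^ e / 2" by simp
  ultimately show ?thesis using L that by (meson less_le_trans)
qed

lemma sum_excess_convergent:
  assumes "e \<le> 1"
  shows "convergent (\<lambda>k. (\<Sum>S\<in>semigroups_frob (2 * k + e). excess (2 * k + e) S) / 2 ^ k)"
proof (rule normalized_sum_convergent[OF assms])
  show "\<bar>excess f S\<bar> \<le> real f + 1" if "S \<in> semigroups_frob f" for f S
    using abs_excess_le[OF that] by simp
  show "(\<Sum>S\<in>top_class (2 * k + e) k. excess (2 * k + e) S) = (2 - real e) / 4 * (2 ^ e / 2) * 2 ^ k"
    if "1 \<le> k" for k
  proof -
    obtain l where k: "k = Suc l" using \<open>1 \<le> k\<close> by (cases k) auto
    have "(\<Sum>S\<in>top_class (2 * k + e) k. excess (2 * k + e) S) =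
        (real (2 * k + 2) - real (2 * k + e)) / 4 * 2 ^ (2 * k + e - k - 1)"
      using that assms by (intro sum_excess_top_class) auto
    also have "2 * k + e - k - 1 = l + e" by (simp add: k)
    finally show ?thesis by (simp add: k power_add)
  qed
qed (rule sum_excess_mult_class_large)

lemma expected_genus_convergent:
  assumes "e \<le> 1"
  shows "\<exists>\<gamma>. (\<lambda>k. expected_genus (2 * k + e) - 3 * real (2 * k + e) / 4) \<longlonglongrightarrow> \<gamma>"
proof -
  let ?N = "\<lambda>k. real (card (semigroups_frob (2 * k + e)))"
  let ?D = "\<lambda>k. \<Sum>S\<in>semigroups_frob (2 * k + e). excess (2 * k + e) S"
  obtain L where L: "L > 0" "(\<lambda>k. ?N k / 2 ^ k) \<longlonglongrightarrow> L"
    using card_semigroups_frob_convergent[OF assms] by blast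
  obtain K where K: "(\<lambda>k. ?D k / 2 ^ k) \<longlonglongrightarrow> K"
    using sum_excess_convergent[OF assms] by (auto simp: convergent_def)
  \<comment> \<open>Positivity of the count lets \<open>?N k\<close> cancel in the centring term; it
    holds eventually because \<open>L > 0\<close>.\<close>
  have "(?D k / 2 ^ k) / (?N k / 2 ^ k) = expected_genus (2 * k + e) - 3 * real (2 * k + e) / 4"
    if "?N k / 2 ^ k > 0" for k
  proof -
    have "?N k > 0" using that by (simp add: zero_less_divide_iff)
    moreover have "?D k = (\<Sum>S\<in>semigroups_frob (2 * k + e). real (genus S))
        - ?N k * (3 * real (2 * k + e) / 4)"
      by (simp add: excess_def sum_subtractf)
    moreover have "(?D k / 2 ^ k) / (?N k / 2 ^ k) = ?D k / ?N k" by simp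
    ultimately show ?thesis
      by (simp only: expected_genus_def diff_divide_distrib) simp
  qed
  then have "\<forall>\<^sub>F k in sequentially. (?D k / 2 ^ k) / (?N k / 2 ^ k) =
      expected_genus (2 * k + e) - 3 * real (2 * k + e) / 4"
    using order_tendstoD(1)[OF L(2) L(1)] by (rule eventually_mono[rotated])
  moreover have "(\<lambda>k. (?D k / 2 ^ k) / (?N k / 2 ^ k)) \<longlonglongrightarrow> K / L"
    using L K by (intro tendsto_divide) auto
  ultimately show ?thesis by (blast intro: Lim_transform_eventually)
qed

theorem theorem5p6:
  shows "\<exists>\<gamma>0 \<gamma>1 :: real.
    ((\<lambda>k. expected_genus (2 * k) - 3 * real (2 * k) / 4) \<longlonglongrightarrow> \<gamma>0) \<and>
    ((\<lambda>k. expected_genus (2 * k + 1) - 3 * real (2 * k + 1) / 4) \<longlonglongrightarrow> \<gamma>1)"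
  using expected_genus_convergent[of 0] expected_genus_convergent[of 1] by auto

end
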